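(* Let $S$ be a set of sorts and $\Sigma$ an $S$-sorted signature such that, for every $S$-sorted set $A$, the support $\{s\in S\mid \mathrm{T}_\Sigma(A)_s\neq\varnothing\}$ of the free $\Sigma$-algebra $\mathbf{T}_\Sigma(A)$ is finite (equivalently, $S$ is finite). Let $\mathcal{L}$ be a function assigning to each $S$-sorted set $A$ a subset $\mathcal{L}(A)$ of the set $\mathrm{Lang_r}(\mathbf{T}_\Sigma(A))$ of regular languages of $\mathbf{T}_\Sigma(A)$. Then $\mathcal{L}$ is a formation of regular languages with respect to $\Sigma$ if, and only if, $\mathcal{L}$ is a BPS-formation of regular languages with respect to $\Sigma$.
   Context: Fix a Grothendieck universe $\mathcal{U}$, a set of sorts $S\in\mathcal{U}$ and an $S$-sorted signature $\Sigma$, i.e. a family of sets $\Sigma_{w,s}\in\mathcal{U}$ indexed by $w\in S^{\star}$ (finite words on $S$) and $s\in S$. An $S$-sorted set is a family $A=(A_s)_{s\in S}$ of sets in $\mathcal{U}$ (components may be empty); it is finite if $\coprod_{s\in S}A_s$ is finite; $\mathcal{U}^S$ is the set of all $S$-sorted sets. Subsets, unions, intersections, complements, inverse images are componentwise; $\mathrm{Sub}(A)$ is the set of all $S$-sorted subsets of $A$. A $\Sigma$-algebra $\mathbf{A}$ is an $S$-sorted set $A$ with an operation $F_\sigma\colon A_w=\prod_{i<|w|}A_{w_i}\to A_s$ for each $\sigma\in\Sigma_{w,s}$. Homomorphisms are $S$-sorted mappings commuting with all operations; epimorphism means homomorphism surjective in each sort. A congruence on $\mathbf{A}$ is a family $\Phi=(\Phi_s)_{s\in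 S}$ of equivalence relations on the $A_s$ compatible with all operations; it is of finite index if $A/\Phi$ is finite; $\mathrm{pr}^\Phi\colon\mathbf{A}\to\mathbf{A}/\Phi$ is the projection; $\nabla^{\mathbf{A}}$ is the greatest congruence; $\mathrm{Ker}(f)$ is the kernel congruence of $f$. $\mathbf{T}_\Sigma(A)$ is the free $\Sigma$-algebra on $A$, with underlying $S$-sorted set $\mathrm{T}_\Sigma(A)$. For a congruence $\Phi$ on $\mathbf{A}$, $L\subseteq A$ is $\Phi$-saturated if each $L_s$ is a union of $\Phi_s$-classes; $\Phi\text{-}\mathrm{Sat}(A)$ is the set of $\Phi$-saturated subsets. $\Omega^{\mathbf{A}}(L)$ is the greatest congruence on $\mathbf{A}$ for which $L$ is saturated. $L\subseteq A$ is regular if $\Omega^{\mathbf{A}}(L)$ is of finite index; $\mathrm{Lang_r}(\mathbf{A})$ is the set of regular $L\subseteq A$. For $t,s\in S$, an elementary translation from $t$ to $s$ is a map $T\colon A_t\to A_s$ of the form $T(x)=F_\sigma(a_0,\dots,a_{i-1},x,a_{i+1},\dots,a_{|w|-1})$ for some nonempty word $w$, $\sigma\in\Sigma_{w,s}$, $i<|w|$ with $w_i=t$, and fixed $a_j\in A_{w_j}$ ($j\neq i$). $\mathrm{Tl}_t(\mathbf{A})_s$, the set of $t$-translations of sort $s$, consists of all composites of finitely many ($\geq1$) elementary translations leading from $t$ to $s$, together with $\mathrm{id}_{A_t}$ when $s=t$. For $T\in\mathrm{Tl}_t(\mathbf{A})_s$ and $L\subseteq A$, $T^{-1}[L]$ is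 the $S$-sorted subset of $A$ with $T^{-1}[L]_t=T^{-1}[L_s]$ and $T^{-1}[L]_u=\varnothing$ for $u\neq t$. $\mathcal{L}$ (with $\mathcal{L}(A)\subseteq\mathrm{Lang_r}(\mathbf{T}_\Sigma(A))$ for all $A\in\mathcal{U}^S$) is a formation of regular languages with respect to $\Sigma$ if: (1) for every $A$, $\nabla^{\mathbf{T}_\Sigma(A)}\text{-}\mathrm{Sat}(\mathrm{T}_\Sigma(A))\subseteq\mathcal{L}(A)$; (2) for every $A$ and $L,L'\in\mathcal{L}(A)$, $(\Omega^{\mathbf{T}_\Sigma(A)}(L)\cap\Omega^{\mathbf{T}_\Sigma(A)}(L'))\text{-}\mathrm{Sat}(\mathrm{T}_\Sigma(A))\subseteq\mathcal{L}(A)$; (3) for all $A,B$, $M\in\mathcal{L}(B)$ and homomorphisms $f\colon\mathbf{T}_\Sigma(A)\to\mathbf{T}_\Sigma(B)$, if $\mathrm{pr}^{\Omega^{\mathbf{T}_\Sigma(B)}(M)}\circ f$ is an epimorphism, then $\mathrm{Ker}(\mathrm{pr}^{\Omega^{\mathbf{T}_\Sigma(B)}(M)}\circ f)\text{-}\mathrm{Sat}(\mathrm{T}_\Sigma(A))\subseteq\mathcal{L}(A)$. $\mathcal{L}$ (with $\mathcal{L}(A)\subseteq\mathrm{Lang_r}(\mathbf{T}_\Sigma(A))$ for all $A$) is a BPS-formation of regular languages with respect to $\Sigma$ if: (BPS 1) for every $A$, $\nabla^{\mathbf{T}_\Sigma(A)}\text{-}\mathrm{Sat}(\mathrm{T}_\Sigma(A))\subseteq\mathcal{L}(A)$;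 (BPS 2) for every $A$, $L\in\mathcal{L}(A)$, $s,t\in S$ and $T\in\mathrm{Tl}_t(\mathbf{T}_\Sigma(A))_s$, $T^{-1}[L]\in\mathcal{L}(A)$; (BPS 3) for every $A$ and $L,L'\in\mathcal{L}(A)$, the sets $L\cup L'$, $L\cap L'$ and the complement of $L$ in $\mathrm{T}_\Sigma(A)$ are in $\mathcal{L}(A)$; (BPS 4) for all $A,B$, $M\in\mathcal{L}(B)$ and homomorphisms $f\colon\mathbf{T}_\Sigma(A)\to\mathbf{T}_\Sigma(B)$, if $\mathrm{pr}^{\Omega^{\mathbf{T}_\Sigma(B)}(M)}\circ f$ is an epimorphism, then $f^{-1}[M]\in\mathcal{L}(A)$. *)

theory Defs
  imports Main
begin

text \<open>
  The sorts form a set \<open>S\<close>, possibly empty, inside a type \<open>'s\<close>. Sorted families are functions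
  on all of \<open>'s\<close>. A family of sets is normalised to be empty outside \<open>S\<close>, so that equality of
  sorted sets is equality of functions, and componentwise conditions may be quantified over
  all of \<open>'s\<close>. Sorted mappings are total functions whose values outside the carriers are
  irrelevant.
\<close>

text \<open>
  \<open>\<U>\<close> is the collection of sets that may occur as components. No closure condition is imposed
  on it. A Grothendieck universe is recovered by letting \<open>'a\<close> be the type of its
  elements and \<open>\<U>\<close> the collection of its members, viewed as subsets of \<open>'a\<close>.
\<close>
definition sorted_sets :: "'s set \<Rightarrow> 'a set set \<Rightarrow> ('s \<Rightarrow> 'a set) set" where
  "sorted_sets S \<U> = {A. (\<forall>s\<in>S. A s \<in> \<U>) \<and> (\<forall>s. s \<notin> S \<longrightarrow> A s = {})}"

text \<open>
  An operation takes its arguments as a list and is tagged with word, sort and symbol, since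
  the sets \<open>\<Sigma> w s\<close> need not be disjoint.
\<close>
record ('s, 'o, 'x) alg =
  carr :: "'s \<Rightarrow> 'x set"
  opr :: "'s list \<Rightarrow> 's \<Rightarrow> 'o \<Rightarrow> 'x list \<Rightarrow> 'x"

definition words_over :: "('s \<Rightarrow> 'x set) \<Rightarrow> 's list \<Rightarrow> 'x list set" where
  "words_over A w = {xs. list_all2 (\<lambda>x s. x \<in> A s) xs w}"
  \<comment> \<open>the product \<open>A\<^sub>w\<close>\<close>

datatype ('s, 'o, 'a) trm = Var 's 'a | App "'s list" 's 'o "('s, 'o, 'a) trm list"

locale signature =
  fixes S :: "'s set" and \<Sigma> :: "'s list \<Rightarrow> 's \<Rightarrow> 'o set"
  assumes sorts: "\<sigma> \<in> \<Sigma> w s \<Longrightarrow> w \<in> lists S \<and> s \<in> S"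
begin

definition hom :: "('s, 'o, 'x) alg \<Rightarrow> ('s, 'o, 'y) alg \<Rightarrow> ('s \<Rightarrow> 'x \<Rightarrow> 'y) \<Rightarrow> bool" where
  "hom A B f \<longleftrightarrow>
     (\<forall>s. f s ` carr A s \<subseteq> carr B s) \<and>
     (\<forall>w s. \<forall>\<sigma>\<in>\<Sigma> w s. \<forall>xs\<in>words_over (carr A) w.
        f s (opr A w s \<sigma> xs) = opr B w s \<sigma> (map2 f w xs))"

definition epi :: "('s, 'o, 'x) alg \<Rightarrow> ('s, 'o, 'y) alg \<Rightarrow> ('s \<Rightarrow> 'x \<Rightarrow> 'y) \<Rightarrow> bool" where
  "epi A B f \<longleftrightarrow> hom A B f \<and> (\<forall>s. f s ` carr A s = carr B s)"

definition congruence :: "('s, 'o, 'x) alg \<Rightarrow> ('s \<Rightarrow> ('x \<times> 'x) set) \<Rightarrow> bool" where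
  "congruence A \<Phi> \<longleftrightarrow>
     (\<forall>s. equiv (carr A s) (\<Phi> s)) \<and>
     (\<forall>w s. \<forall>\<sigma>\<in>\<Sigma> w s. \<forall>xs\<in>words_over (carr A) w. \<forall>ys\<in>words_over (carr A) w.
        (\<forall>i<length w. (xs ! i, ys ! i) \<in> \<Phi> (w ! i)) \<longrightarrow>
        (opr A w s \<sigma> xs, opr A w s \<sigma> ys) \<in> \<Phi> s)"

definition finite_index :: "('s, 'o, 'x) alg \<Rightarrow> ('s \<Rightarrow> ('x \<times> 'x) set) \<Rightarrow> bool" where
  "finite_index A \<Phi> \<longleftrightarrow> finite (SIGMA s:S. carr A s // \<Phi> s)"

text \<open>
  For a congruence, the union below is the common class of all values
  \<open>opr A w s \<sigma> xs\<close> on choices \<open>xs\<close> of representatives of the classes \<open>Xs\<close>.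
\<close>
definition quotient_alg ::
  "('s, 'o, 'x) alg \<Rightarrow> ('s \<Rightarrow> ('x \<times> 'x) set) \<Rightarrow> ('s, 'o, 'x set) alg" where
  "quotient_alg A \<Phi> =
     \<lparr>carr = (\<lambda>s. carr A s // \<Phi> s),
      opr = (\<lambda>w s \<sigma> Xs. \<Union>xs\<in>{xs. list_all2 (\<in>) xs Xs}. \<Phi> s `` {opr A w s \<sigma> xs})\<rparr>"

definition proj :: "('s \<Rightarrow> ('x \<times> 'x) set) \<Rightarrow> 's \<Rightarrow> 'x \<Rightarrow> 'x set" where
  "proj \<Phi> s x = \<Phi> s `` {x}"

definition Ker :: "('s, 'o, 'x) alg \<Rightarrow> ('s \<Rightarrow> 'x \<Rightarrow> 'y) \<Rightarrow> 's \<Rightarrow> ('x \<times> 'x) set" where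
  "Ker A f s = {(x, y). x \<in> carr A s \<and> y \<in> carr A s \<and> f s x = f s y}"

definition Sat :: "('s, 'o, 'x) alg \<Rightarrow> ('s \<Rightarrow> ('x \<times> 'x) set) \<Rightarrow> ('s \<Rightarrow> 'x set) set" where
  "Sat A \<Phi> = {L. \<forall>s. \<exists>C \<subseteq> carr A s // \<Phi> s. L s = \<Union>C}"

text \<open>Congruences are compared by the pointwise order, i.e. by inclusion in each sort.
  \<open>Omega\<close> is meaningful for \<open>L\<close> contained in the carrier, where the greatest congruence exists.\<close>

definition nabla :: "('s, 'o, 'x) alg \<Rightarrow> 's \<Rightarrow> ('x \<times> 'x) set" where
  "nabla A = (GREATEST \<Phi>. congruence A \<Phi>)"

definition Omega :: "('s, 'o, 'x) alg \<Rightarrow> ('s \<Rightarrow> 'x set) \<Rightarrow> 's \<Rightarrow> ('x \<times> 'x) set" where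
  "Omega A L = (GREATEST \<Phi>. congruence A \<Phi> \<and> L \<in> Sat A \<Phi>)"

definition Lang_r :: "('s, 'o, 'x) alg \<Rightarrow> ('s \<Rightarrow> 'x set) set" where
  "Lang_r A = {L. (\<forall>s. L s \<subseteq> carr A s) \<and> finite_index A (Omega A L)}"

definition elementary_translation ::
  "('s, 'o, 'x) alg \<Rightarrow> 's \<Rightarrow> 's \<Rightarrow> ('x \<Rightarrow> 'x) \<Rightarrow> bool" where
  "elementary_translation A t s T \<longleftrightarrow>
     (\<exists>w. \<exists>\<sigma>\<in>\<Sigma> w s. \<exists>i<length w. \<exists>as.
        w ! i = t \<and> length as = length w \<and>
        (\<forall>j<length w. j \<noteq> i \<longrightarrow> as ! j \<in> carr A (w ! j)) \<and>
        T = (\<lambda>x. opr A w s \<sigma> (as[i := x])))"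

text \<open>
  A composite of \<open>n \<ge> 1\<close> elementary translations is obtained from the identity by \<open>n\<close> uses of
  \<open>trans_comp\<close>. As for sorted mappings, only the restriction of a translation to \<open>carr A t\<close> matters.
\<close>
inductive translation :: "('s, 'o, 'x) alg \<Rightarrow> 's \<Rightarrow> 's \<Rightarrow> ('x \<Rightarrow> 'x) \<Rightarrow> bool"
  for A t where
  trans_id: "t \<in> S \<Longrightarrow> translation A t t (\<lambda>x. x)"
| trans_comp: "translation A t s T \<Longrightarrow> elementary_translation A s u E \<Longrightarrow>
    translation A t u (\<lambda>x. E (T x))"

definition Tl :: "('s, 'o, 'x) alg \<Rightarrow> 's \<Rightarrow> 's \<Rightarrow> ('x \<Rightarrow> 'x) set" where
  "Tl A t s = {T. translation A t s T}"

definition vimage_trans ::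
  "('s, 'o, 'x) alg \<Rightarrow> 's \<Rightarrow> 's \<Rightarrow> ('x \<Rightarrow> 'x) \<Rightarrow> ('s \<Rightarrow> 'x set) \<Rightarrow> 's \<Rightarrow> 'x set" where
  "vimage_trans A t s T L = (\<lambda>u. if u = t then {x \<in> carr A t. T x \<in> L s} else {})"

inductive is_term :: "('s \<Rightarrow> 'a set) \<Rightarrow> 's \<Rightarrow> ('s, 'o, 'a) trm \<Rightarrow> bool"
  for A where
  term_Var: "s \<in> S \<Longrightarrow> x \<in> A s \<Longrightarrow> is_term A s (Var s x)"
| term_App: "\<sigma> \<in> \<Sigma> w s \<Longrightarrow> list_all2 (is_term A) w ps \<Longrightarrow> is_term A s (App w s \<sigma> ps)"

definition free_alg :: "('s \<Rightarrow> 'a set) \<Rightarrow> ('s, 'o, ('s, 'o, 'a) trm) alg" where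
  "free_alg A = \<lparr>carr = (\<lambda>s. {p. is_term A s p}), opr = App\<rparr>"

definition formation ::
  "'a set set \<Rightarrow> (('s \<Rightarrow> 'a set) \<Rightarrow> ('s \<Rightarrow> ('s, 'o, 'a) trm set) set) \<Rightarrow> bool" where
  "formation \<U> \<L> \<longleftrightarrow>
     (\<forall>A\<in>sorted_sets S \<U>. \<L> A \<subseteq> Lang_r (free_alg A)) \<and>
     (\<forall>A\<in>sorted_sets S \<U>. Sat (free_alg A) (nabla (free_alg A)) \<subseteq> \<L> A) \<and>
     (\<forall>A\<in>sorted_sets S \<U>. \<forall>L\<in>\<L> A. \<forall>L'\<in>\<L> A.
        Sat (free_alg A) (\<lambda>s. Omega (free_alg A) L s \<inter> Omega (free_alg A) L' s) \<subseteq> \<L> A) \<and>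
     (\<forall>A\<in>sorted_sets S \<U>. \<forall>B\<in>sorted_sets S \<U>. \<forall>M\<in>\<L> B. \<forall>f.
        let pf = (\<lambda>s. proj (Omega (free_alg B) M) s \<circ> f s) in
        hom (free_alg A) (free_alg B) f \<longrightarrow>
        epi (free_alg A) (quotient_alg (free_alg B) (Omega (free_alg B) M)) pf \<longrightarrow>
        Sat (free_alg A) (Ker (free_alg A) pf) \<subseteq> \<L> A)"

definition bps_formation ::
  "'a set set \<Rightarrow> (('s \<Rightarrow> 'a set) \<Rightarrow> ('s \<Rightarrow> ('s, 'o, 'a) trm set) set) \<Rightarrow> bool" where
  "bps_formation \<U> \<L> \<longleftrightarrow>
     (\<forall>A\<in>sorted_sets S \<U>. \<L> A \<subseteq> Lang_r (free_alg A)) \<and>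
     (\<forall>A\<in>sorted_sets S \<U>. Sat (free_alg A) (nabla (free_alg A)) \<subseteq> \<L> A) \<and>
     (\<forall>A\<in>sorted_sets S \<U>. \<forall>L\<in>\<L> A. \<forall>s\<in>S. \<forall>t\<in>S. \<forall>T\<in>Tl (free_alg A) t s.
        vimage_trans (free_alg A) t s T L \<in> \<L> A) \<and>
     (\<forall>A\<in>sorted_sets S \<U>. \<forall>L\<in>\<L> A. \<forall>L'\<in>\<L> A.
        (\<lambda>s. L s \<union> L' s) \<in> \<L> A \<and>
        (\<lambda>s. L s \<inter> L' s) \<in> \<L> A \<and>
        (\<lambda>s. carr (free_alg A) s - L s) \<in> \<L> A) \<and>
     (\<forall>A\<in>sorted_sets S \<U>. \<forall>B\<in>sorted_sets S \<U>. \<forall>M\<in>\<L> B. \<forall>f.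
        let pf = (\<lambda>s. proj (Omega (free_alg B) M) s \<circ> f s) in
        hom (free_alg A) (free_alg B) f \<longrightarrow>
        epi (free_alg A) (quotient_alg (free_alg B) (Omega (free_alg B) M)) pf \<longrightarrow>
        (\<lambda>s. {p \<in> carr (free_alg A) s. f s p \<in> M s}) \<in> \<L> A)"

end

end

theory Submission
  imports Defs
begin

text \<open>
  Two elements are related by \<open>Omega A L\<close> iff no translation into \<open>L\<close> separates them. Hence the
  languages occurring in (BPS 2), (BPS 3) and (BPS 4) are saturated for the congruences occurring
  in (2) and (3). Conversely, a class of \<open>Omega A L\<close> is an intersection of sets \<open>T\<^sup>-\<^sup>1[L]\<close> and
  complements of such sets; as \<open>L\<close> is regular, only finitely many of them are distinct, and every
  saturated language is a finite union of classes, which gives (2). For (3), translations of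
  the free algebra on \<open>B\<close> lift along the epimorphism, up to \<open>Omega M\<close>, to translations of the free
  algebra on \<open>A\<close>. Therefore the kernel contains \<open>Omega (f\<^sup>-\<^sup>1[M])\<close>, and (3) follows from (BPS 4)
  and (2).
\<close>

text \<open>Languages living in a single sort. They are the building blocks from which a saturated
  language is assembled as a finite union.\<close>

definition concentrated :: "'s \<Rightarrow> 'x set \<Rightarrow> 's \<Rightarrow> 'x set" where
  "concentrated s X = (\<lambda>u. if u = s then X else {})"

context signature
begin

section \<open>Saturated families, and algebras closed under their operations\<close>

lemma Sat_iff:
  assumes eq: "\<And>s. equiv (carr A s) (\<Phi> s)"
  shows "L \<in> Sat A \<Phi> \<longleftrightarrow>
    (\<forall>s. L s \<subseteq> carr A s) \<and> (\<forall>s x y. (x, y) \<in> \<Phi> s \<longrightarrow> x \<in> L s \<longrightarrow> y \<in> L s)"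
proof
  assume "L \<in> Sat A \<Phi>"
  then have C: "\<exists>C \<subseteq> carr A s // \<Phi> s. L s = \<Union>C" for s
    by (simp add: Sat_def)
  have "L s \<subseteq> carr A s" for s
    using C[of s] in_quotient_imp_subset[OF eq[of s]] by blast
  moreover have "y \<in> L s" if xy: "(x, y) \<in> \<Phi> s" and x: "x \<in> L s" for s x y
  proof -
    obtain C where C': "C \<subseteq> carr A s // \<Phi> s" "L s = \<Union>C"
      using C[of s] by blast
    then obtain X where X: "X \<in> C" "x \<in> X"
      using x by blast
    then have "y \<in> X"
      using in_quotient_imp_closed[OF eq[of s] _ X(2) xy] C' by blast
    then show ?thesis
      using C' X by blast
  qed
  ultimately show "(\<forall>s. L s \<subseteq> carr A s) \<and> (\<forall>s x y. (x, y) \<in> \<Phi> s \<longrightarrow> x \<in> L s \<longrightarrow> y \<in> L s)"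
    by blast
next
  assume L: "(\<forall>s. L s \<subseteq> carr A s) \<and> (\<forall>s x y. (x, y) \<in> \<Phi> s \<longrightarrow> x \<in> L s \<longrightarrow> y \<in> L s)"
  have "\<exists>C \<subseteq> carr A s // \<Phi> s. L s = \<Union>C" for s
  proof (intro exI conjI)
    show "(\<lambda>x. \<Phi> s `` {x}) ` L s \<subseteq> carr A s // \<Phi> s"
      using L by (auto intro: quotientI)
    show "L s = \<Union>((\<lambda>x. \<Phi> s `` {x}) ` L s)"
      using L equiv_class_self[OF eq[of s]] by blast
  qed
  then show "L \<in> Sat A \<Phi>"
    by (simp add: Sat_def)
qed

text \<open>The record type does not force operations to land in the carrier. Emptiness outside
  \<open>S\<close> ensures that every element lives in a sort possessing an identity
  translation.\<close>

definition algebra :: "('s, 'o, 'x) alg \<Rightarrow> bool" where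
  "algebra A \<longleftrightarrow>
     (\<forall>s. s \<notin> S \<longrightarrow> carr A s = {}) \<and>
     (\<forall>w s. \<forall>\<sigma>\<in>\<Sigma> w s. \<forall>xs\<in>words_over (carr A) w. opr A w s \<sigma> xs \<in> carr A s)"

lemma algebra_free_alg: "algebra (free_alg A)"
proof -
  have "s \<in> S" if "is_term A s p" for s p
    using that by cases (auto dest: sorts)
  then show ?thesis
    unfolding algebra_def free_alg_def words_over_def
    by (auto simp: list_all2_conv_all_nth intro!: term_App)
qed

lemma words_over_nth_iff:
  "xs \<in> words_over X w \<longleftrightarrow> length xs = length w \<and> (\<forall>i<length w. xs ! i \<in> X (w ! i))"
  by (auto simp: words_over_def list_all2_conv_all_nth)

section \<open>Translations and congruences\<close>

lemma hom_closed: "hom A B f \<Longrightarrow> x \<in> carr A s \<Longrightarrow> f s x \<in> carr B s"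
  by (auto simp: hom_def)

lemma elementary_translationI:
  assumes "\<sigma> \<in> \<Sigma> w s" "i < length w" "as \<in> words_over (carr A) w"
  shows "elementary_translation A (w ! i) s (\<lambda>x. opr A w s \<sigma> (as[i := x]))"
  using assms unfolding elementary_translation_def words_over_nth_iff by blast

text \<open>The entry of \<open>as\<close> at position \<open>i\<close> is arbitrary, so only the
  updated list is known to be a word over the carrier. Both the updated and the punctured form are
  needed later.\<close>

lemma elementary_translationE:
  assumes "elementary_translation A t s E"
  obtains w \<sigma> i as where "\<sigma> \<in> \<Sigma> w s" "i < length w" "w ! i = t"
    "\<And>x. x \<in> carr A t \<Longrightarrow> as[i := x] \<in> words_over (carr A) w"
    "E = (\<lambda>x. opr A w s \<sigma> (as[i := x]))" "length as = length w"
    "\<And>j. j < length w \<Longrightarrow> j \<noteq> i \<Longrightarrow> as ! j \<in> carr A (w ! j)"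
proof -
  obtain w \<sigma> i as where w: "\<sigma> \<in> \<Sigma> w s" "i < length w" "w ! i = t" "length as = length w"
    "\<forall>j<length w. j \<noteq> i \<longrightarrow> as ! j \<in> carr A (w ! j)" "E = (\<lambda>x. opr A w s \<sigma> (as[i := x]))"
    using assms unfolding elementary_translation_def by blast
  then show thesis
    by (intro that[of \<sigma> w i as]) (auto simp: words_over_nth_iff nth_list_update)
qed

lemma elementary_translation_sorts:
  assumes "elementary_translation A t s E"
  shows "t \<in> S" "s \<in> S"
  using assms sorts unfolding elementary_translation_def by (metis in_lists_conv_set nth_mem)+

lemma elementary_translation_closed:
  assumes "algebra A" "elementary_translation A t s E" "x \<in> carr A t"
  shows "E x \<in> carr A s"
  using assms(2)
proof (rule elementary_translationE)
qed (use assms in \<open>simp add: algebra_def\<close>)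

lemma translation_sorts:
  assumes "translation A t s T"
  shows "t \<in> S" "s \<in> S"
  using assms by induction (auto dest: elementary_translation_sorts)

lemma translation_closed:
  assumes "translation A t s T" "algebra A" "x \<in> carr A t"
  shows "T x \<in> carr A s"
  using assms by induction (auto intro: elementary_translation_closed)

text \<open>The inductive definition adds elementary translations on the outside. Adding one on the
  inside is what makes inseparability compatible with the operations.\<close>

lemma translation_precomp:
  assumes "translation A t s T" "elementary_translation A r t E"
  shows "translation A r s (\<lambda>x. T (E x))"
  using assms
proof induction
  case trans_id
  then show ?case
    using translation.trans_comp[OF translation.trans_id] elementary_translation_sorts(1) by metis
next
  case (trans_comp s T u F)
  then show ?case
    using translation.trans_comp[of A r s "\<lambda>x. T (E x)" u F] by simp
qed

text \<open>From left to right, the arguments held fixed are related to themselves by reflexivity.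
  From right to left, transitivity chains the changes of single arguments. Compatibility thus
  reduces to unary maps, the form in which translations can be used.\<close>

lemma congruence_iff_elementary:
  assumes alg: "algebra A"
  shows "congruence A \<Phi> \<longleftrightarrow> (\<forall>s. equiv (carr A s) (\<Phi> s)) \<and>
    (\<forall>t s E x y. elementary_translation A t s E \<longrightarrow> (x, y) \<in> \<Phi> t \<longrightarrow> (E x, E y) \<in> \<Phi> s)"
    (is "?cong \<longleftrightarrow> ?eq \<and> ?elem")
proof
  assume cong: ?cong
  then have eq: "equiv (carr A s) (\<Phi> s)" for s
    by (simp add: congruence_def)
  have "(E x, E y) \<in> \<Phi> s"
    if E: "elementary_translation A t s E" and xy: "(x, y) \<in> \<Phi> t" for t s E x y
  proof -
    obtain w \<sigma> i as where w: "\<sigma> \<in> \<Sigma> w s" "i < length w" "w ! i = t"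
      "\<And>x. x \<in> carr A t \<Longrightarrow> as[i := x] \<in> words_over (carr A) w"
      "E = (\<lambda>x. opr A w s \<sigma> (as[i := x]))" "length as = length w"
      "\<And>j. j < length w \<Longrightarrow> j \<noteq> i \<Longrightarrow> as ! j \<in> carr A (w ! j)"
      using elementary_translationE[OF E] by metis
    have "x \<in> carr A t" "y \<in> carr A t"
      using xy eq[of t] equivE equiv_type by blast+
    moreover have "(as[i := x] ! j, as[i := y] ! j) \<in> \<Phi> (w ! j)" if "j < length w" for j
      using that w xy eq[of "w ! j"] by (cases "j = i") (auto simp: equiv_def refl_on_def)
    ultimately show ?thesis
      using cong w unfolding congruence_def by blast
  qed
  then show "?eq \<and> ?elem"
    using eq by blast
next
  assume R: "?eq \<and> ?elem"
  have "(opr A w s \<sigma> xs, opr A w s \<sigma> ys) \<in> \<Phi> s"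
    if \<sigma>: "\<sigma> \<in> \<Sigma> w s" and xs: "xs \<in> words_over (carr A) w" and ys: "ys \<in> words_over (carr A) w"
      and xy: "\<forall>i<length w. (xs ! i, ys ! i) \<in> \<Phi> (w ! i)" for w s \<sigma> xs ys
  proof -
    \<comment> \<open>replace the arguments one at a time, from the left\<close>
    define zs where "zs k = take k ys @ drop k xs" for k
    have len: "length xs = length w" "length ys = length w"
      using xs ys by (auto simp: words_over_nth_iff)
    have zs: "zs k \<in> words_over (carr A) w" if "k \<le> length w" for k
      using that xs ys by (auto simp: zs_def words_over_nth_iff nth_append)
    have "k \<le> length w \<Longrightarrow> (opr A w s \<sigma> xs, opr A w s \<sigma> (zs k)) \<in> \<Phi> s" for k
    proof (induction k)
      case 0
      have "opr A w s \<sigma> xs \<in> carr A s"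
        using alg \<sigma> xs by (simp add: algebra_def)
      then show ?case
        using R by (simp add: zs_def equiv_def refl_on_def)
    next
      case (Suc k)
      then have k: "k < length w"
        by simp
      have x: "(zs k)[k := xs ! k] = zs k"
        using k len by (intro nth_equalityI) (auto simp: zs_def nth_append nth_list_update)
      have y: "(zs k)[k := ys ! k] = zs (Suc k)"
        using k len
        by (intro nth_equalityI) (auto simp: zs_def nth_append nth_list_update less_Suc_eq)
      have "elementary_translation A (w ! k) s (\<lambda>x. opr A w s \<sigma> ((zs k)[k := x]))"
        using elementary_translationI[OF \<sigma> k zs] k by simp
      then have "(opr A w s \<sigma> ((zs k)[k := xs ! k]), opr A w s \<sigma> ((zs k)[k := ys ! k])) \<in> \<Phi> s"
        using R xy k by blast
      then have "(opr A w s \<sigma> (zs k), opr A w s \<sigma> (zs (Suc k))) \<in> \<Phi> s"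
        by (simp add: x y)
      then show ?case
        using Suc R by (meson Suc_leD equivE transD)
    qed
    from this[of "length w"] show ?thesis
      using len by (simp add: zs_def)
  qed
  then show ?cong
    using R by (simp add: congruence_def)
qed

lemma congruence_translation:
  assumes "translation A t s T" "congruence A \<Phi>" "algebra A" "(x, y) \<in> \<Phi> t"
  shows "(T x, T y) \<in> \<Phi> s"
  using assms by induction (auto simp: congruence_iff_elementary)

section \<open>The congruences \<open>nabla\<close> and \<open>Omega\<close>\<close>

lemma nabla_eq:
  assumes "algebra A"
  shows "nabla A = (\<lambda>s. carr A s \<times> carr A s)"
  unfolding nabla_def
proof (rule Greatest_equality)
  show "congruence A (\<lambda>s. carr A s \<times> carr A s)"
    using assms
    by (auto simp: congruence_iff_elementary equiv_def refl_on_def sym_def trans_def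
        intro: elementary_translation_closed)
next
  fix \<Phi>
  assume "congruence A \<Phi>"
  then show "\<Phi> \<le> (\<lambda>s. carr A s \<times> carr A s)"
    using equiv_type by (fastforce simp: le_fun_def congruence_def)
qed

text \<open>The syntactic congruence of \<open>L\<close>, with translations in the role that
  two-sided contexts play for words.\<close>

definition inseparable ::
  "('s, 'o, 'x) alg \<Rightarrow> ('s \<Rightarrow> 'x set) \<Rightarrow> 's \<Rightarrow> ('x \<times> 'x) set" where
  "inseparable A L s = {(x, y). x \<in> carr A s \<and> y \<in> carr A s \<and>
     (\<forall>u T. translation A s u T \<longrightarrow> (T x \<in> L u \<longleftrightarrow> T y \<in> L u))}"

lemma congruence_inseparable:
  assumes "algebra A"
  shows "congruence A (inseparable A L)"
  unfolding congruence_iff_elementary[OF assms]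
proof (intro conjI allI impI)
  show "equiv (carr A s) (inseparable A L s)" for s
    by (auto simp: inseparable_def equiv_def refl_on_def sym_def trans_def)
  show "(E x, E y) \<in> inseparable A L s"
    if "elementary_translation A t s E" "(x, y) \<in> inseparable A L t" for t s E x y
    using that assms
    by (auto simp: inseparable_def intro: elementary_translation_closed dest: translation_precomp)
qed

text \<open>Inseparability saturates \<open>L\<close> because the identity is a translation. It is
  the greatest such congruence because every congruence is preserved by translations, so related
  elements of a saturating congruence cannot be separated.\<close>

lemma Omega_eq:
  assumes alg: "algebra A" and L: "\<And>s. L s \<subseteq> carr A s"
  shows "Omega A L = inseparable A L"
  unfolding Omega_def
proof (rule Greatest_equality)
  have cong: "congruence A (inseparable A L)"
    using alg by (rule congruence_inseparable)
  then have eq: "\<And>s. equiv (carr A s) (inseparable A L s)"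
    by (simp add: congruence_def)
  have "y \<in> L s" if xy: "(x, y) \<in> inseparable A L s" and x: "x \<in> L s" for s x y
  proof -
    have "s \<in> S"
      using alg L[of s] x by (auto simp: algebra_def)
    then show ?thesis
      using xy x trans_id[of s A] unfolding inseparable_def by blast
  qed
  then show "congruence A (inseparable A L) \<and> L \<in> Sat A (inseparable A L)"
    using cong L by (auto simp: Sat_iff[OF eq])
next
  fix \<Phi>
  assume \<Phi>: "congruence A \<Phi> \<and> L \<in> Sat A \<Phi>"
  then have eq: "\<And>s. equiv (carr A s) (\<Phi> s)"
    by (simp add: congruence_def)
  have sat: "\<And>s x y. (x, y) \<in> \<Phi> s \<Longrightarrow> x \<in> L s \<Longrightarrow> y \<in> L s"
    using \<Phi> Sat_iff[OF eq] by blast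
  have "(x, y) \<in> inseparable A L s" if xy: "(x, y) \<in> \<Phi> s" for s x y
  proof -
    \<comment> \<open>Saturation as stated in \<open>sat\<close> transports membership in one
      direction only; symmetry supplies the other.\<close>
    have "(y, x) \<in> \<Phi> s"
      using xy eq[of s] by (meson equivE symD)
    then have "T x \<in> L u \<longleftrightarrow> T y \<in> L u" if "translation A s u T" for u T
      using congruence_translation[OF that] \<Phi> alg xy sat by blast
    moreover have "x \<in> carr A s" "y \<in> carr A s"
      using xy eq[of s] equiv_type by blast+
    ultimately show ?thesis
      by (simp add: inseparable_def)
  qed
  then show "\<Phi> \<le> inseparable A L"
    by (auto simp: le_fun_def)
qed

lemma
  assumes "algebra A" "\<And>s. L s \<subseteq> carr A s"
  shows congruence_Omega: "congruence A (Omega A L)"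
    and equiv_Omega: "equiv (carr A s) (Omega A L s)"
    and Omega_saturates: "(x, y) \<in> Omega A L s \<Longrightarrow> x \<in> L s \<longleftrightarrow> y \<in> L s"
proof -
  show cong: "congruence A (Omega A L)"
    using assms by (simp add: Omega_eq congruence_inseparable)
  then show "equiv (carr A s) (Omega A L s)"
    by (simp add: congruence_def)
  assume xy: "(x, y) \<in> Omega A L s"
  then have "x \<in> carr A s" and "(x, y) \<in> inseparable A L s"
    by (simp_all add: Omega_eq[OF assms] inseparable_def)
  moreover from this have "translation A s s (\<lambda>x. x)"
    using assms(1) by (intro trans_id) (auto simp: algebra_def)
  ultimately show "x \<in> L s \<longleftrightarrow> y \<in> L s"
    unfolding inseparable_def by blast
qed

lemma equiv_inf_Omega:
  assumes "algebra A" "\<And>s. L s \<subseteq> carr A s" "\<And>s. L' s \<subseteq> carr A s"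
  shows "equiv (carr A s) (Omega A L s \<inter> Omega A L' s)"
  using equiv_Omega[of A L s, OF assms(1,2)] equiv_Omega[of A L' s, OF assms(1,3)]
  by (auto simp: equiv_def refl_on_def intro: sym_Int trans_Int)

lemma Sat_inf_Omega_iff:
  assumes "algebra A" "\<And>s. L s \<subseteq> carr A s" "\<And>s. L' s \<subseteq> carr A s"
  shows "K \<in> Sat A (\<lambda>s. Omega A L s \<inter> Omega A L' s) \<longleftrightarrow> (\<forall>s. K s \<subseteq> carr A s) \<and>
    (\<forall>s x y. (x, y) \<in> Omega A L s \<longrightarrow> (x, y) \<in> Omega A L' s \<longrightarrow> x \<in> K s \<longrightarrow> y \<in> K s)"
  using equiv_inf_Omega[OF assms] by (subst Sat_iff) auto

text \<open>Each nonempty sort is a single class of \<open>nabla\<close>, and the choice between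
  empty and full is made independently in each sort.\<close>

lemma Sat_nabla_iff:
  assumes "algebra A"
  shows "K \<in> Sat A (nabla A) \<longleftrightarrow> (\<forall>s. K s = {} \<or> K s = carr A s)"
proof -
  have "equiv (carr A s) (nabla A s)" for s
    using assms by (auto simp: nabla_eq equiv_def refl_on_def sym_def trans_def)
  then show ?thesis
    by (subst Sat_iff) (auto simp: nabla_eq[OF assms], blast+)
qed

section \<open>Boolean closed families of regular languages\<close>

lemma Lang_r_subset_carr: "L \<in> Lang_r A \<Longrightarrow> L s \<subseteq> carr A s"
  by (simp add: Lang_r_def)

text \<open>Within sort \<open>s\<close>, the admissible sets form a Boolean algebra
  \<open>D\<close> that contains all inverse images of \<open>L\<close> under translations from
  \<open>s\<close>. Regularity leaves finitely many of these, so the class of \<open>x\<close> is a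
  finite intersection in \<open>D\<close>.\<close>

lemma concentrated_Omega_class:
  assumes alg: "algebra A" and reg: "\<B> \<subseteq> Lang_r A" and nab: "Sat A (nabla A) \<subseteq> \<B>"
    and int: "\<And>L L'. L \<in> \<B> \<Longrightarrow> L' \<in> \<B> \<Longrightarrow> (\<lambda>s. L s \<inter> L' s) \<in> \<B>"
    and compl: "\<And>L. L \<in> \<B> \<Longrightarrow> (\<lambda>s. carr A s - L s) \<in> \<B>"
    and vim: "\<And>L s t T. L \<in> \<B> \<Longrightarrow> s \<in> S \<Longrightarrow> t \<in> S \<Longrightarrow> T \<in> Tl A t s \<Longrightarrow>
      vimage_trans A t s T L \<in> \<B>"
    and L: "L \<in> \<B>" and x: "x \<in> carr A s"
  shows "concentrated s (Omega A L s `` {x}) \<in> \<B>"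
proof -
  define D where "D = {X. X \<subseteq> carr A s \<and> concentrated s X \<in> \<B>}"
  \<comment> \<open>The language that is full in sort \<open>s\<close> and empty elsewhere is
    saturated for \<open>nabla\<close>.\<close>
  have Dcarr: "carr A s \<in> D"
    using nab by (auto simp: D_def Sat_nabla_iff[OF alg] concentrated_def)
  have Dint: "X \<inter> Y \<in> D" if "X \<in> D" "Y \<in> D" for X Y
  proof -
    have "concentrated s (X \<inter> Y) = (\<lambda>u. concentrated s X u \<inter> concentrated s Y u)"
      by (auto simp: concentrated_def fun_eq_iff)
    then show ?thesis
      using that int by (auto simp: D_def)
  qed
  have Dcompl: "carr A s - X \<in> D" if "X \<in> D" for X
  proof -
    \<comment> \<open>The complement in \<open>A\<close> is full in all other sorts; intersecting
      with the carrier concentrated in \<open>s\<close> removes these.\<close>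
    have "concentrated s (carr A s - X) =
        (\<lambda>u. concentrated s (carr A s) u \<inter> (carr A u - concentrated s X u))"
      by (auto simp: concentrated_def fun_eq_iff)
    then show ?thesis
      using that int compl Dcarr by (auto simp: D_def)
  qed
  \<comment> \<open>The factor \<open>carr A s\<close> gives the empty intersection its proper
    value, since \<open>\<Inter>{}\<close> is the whole type.\<close>
  have DInt: "carr A s \<inter> \<Inter>G \<in> D" if "finite G" "G \<subseteq> D" for G
    using that
  proof induction
    case empty
    then show ?case
      using Dcarr by simp
  next
    case (insert X G)
    then have "X \<inter> (carr A s \<inter> \<Inter>G) \<in> D"
      using Dint by simp
    then show ?case
      by (simp add: Int_left_commute)
  qed
  have Ls: "\<And>s. L s \<subseteq> carr A s"
    using L reg Lang_r_subset_carr by blast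
  note Om = Omega_eq[OF alg Ls] and eq = equiv_Omega[OF alg Ls, of s]
  have s: "s \<in> S"
    using alg x by (auto simp: algebra_def)
  define F where "F = {{y \<in> carr A s. T y \<in> L u} | u T. translation A s u T}"
  have FD: "F \<subseteq> D"
  proof
    fix X
    assume "X \<in> F"
    then obtain u T where T: "translation A s u T" and X: "X = {y \<in> carr A s. T y \<in> L u}"
      by (auto simp: F_def)
    have "concentrated s X = vimage_trans A s u T L"
      by (auto simp: concentrated_def vimage_trans_def X)
    then show "X \<in> D"
      using vim[OF L _ s, of u T] T translation_sorts[OF T] X by (auto simp: D_def Tl_def)
  qed
  have "finite (SIGMA s:S. carr A s // Omega A L s)"
    using L reg by (auto simp: Lang_r_def finite_index_def)
  \<comment> \<open>Finite index concerns the disjoint union over all sorts; its second projection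
    contains the quotient of sort \<open>s\<close> because \<open>s \<in> S\<close>.\<close>
  then have "finite (snd ` (SIGMA s:S. carr A s // Omega A L s))"
    by (rule finite_imageI)
  then have fin: "finite (carr A s // Omega A L s)"
    by (rule rev_finite_subset) (use s in force)
  \<comment> \<open>Inseparable elements agree on every member of \<open>F\<close>, so each member
    is a union of classes, and there are finitely many such unions.\<close>
  have "F \<subseteq> Union ` Pow (carr A s // Omega A L s)"
  proof
    fix X
    assume "X \<in> F"
    then obtain u T where T: "translation A s u T" and X: "X = {y \<in> carr A s. T y \<in> L u}"
      by (auto simp: F_def)
    have "X = \<Union>((\<lambda>y. Omega A L s `` {y}) ` X)"
    proof
      show "X \<subseteq> \<Union>((\<lambda>y. Omega A L s `` {y}) ` X)"
        using equiv_class_self[OF eq] by (auto simp: X)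
      show "\<Union>((\<lambda>y. Omega A L s `` {y}) ` X) \<subseteq> X"
        using T by (auto simp: X Om inseparable_def)
    qed
    moreover have "(\<lambda>y. Omega A L s `` {y}) ` X \<in> Pow (carr A s // Omega A L s)"
      by (auto simp: X intro: quotientI)
    ultimately show "X \<in> Union ` Pow (carr A s // Omega A L s)"
      by (rule image_eqI)
  qed
  then have finF: "finite F"
    by (rule finite_subset) (use fin in simp)
  \<comment> \<open>From each member of \<open>F\<close> and its complement, \<open>G\<close> keeps
    the one containing \<open>x\<close>. Belonging to all of \<open>G\<close> then means agreeing
    with \<open>x\<close> under every translation.\<close>
  define G where "G = {X \<in> F \<union> (\<lambda>X. carr A s - X) ` F. x \<in> X}"
  have "finite G" "G \<subseteq> D"
    using finF FD Dcompl by (auto simp: G_def)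
  then have "carr A s \<inter> \<Inter>G \<in> D"
    by (rule DInt)
  moreover have "carr A s \<inter> \<Inter>G = Omega A L s `` {x}"
  proof
    show "Omega A L s `` {x} \<subseteq> carr A s \<inter> \<Inter>G"
      by (auto simp: G_def F_def Om inseparable_def)
    show "carr A s \<inter> \<Inter>G \<subseteq> Omega A L s `` {x}"
    proof
      fix y
      assume y: "y \<in> carr A s \<inter> \<Inter>G"
      have "T x \<in> L u \<longleftrightarrow> T y \<in> L u" if "translation A s u T" for u T
      proof -
        have "{y \<in> carr A s. T y \<in> L u} \<in> F"
          using that by (auto simp: F_def)
        then have "{y \<in> carr A s. T y \<in> L u} \<in> G \<or> carr A s - {y \<in> carr A s. T y \<in> L u} \<in> G"
          using x by (auto simp: G_def)
        then show ?thesis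
          using x y by (auto simp: G_def)
      qed
      then show "y \<in> Omega A L s `` {x}"
        using x y by (auto simp: Om inseparable_def)
    qed
  qed
  ultimately show ?thesis
    by (simp add: D_def)
qed

text \<open>A class of the intersected congruence is the intersection of a class for
  \<open>L\<close> with one for \<open>L'\<close>. Regularity of both leaves finitely many classes
  over all sorts together, so \<open>K\<close> is a finite union of concentrated classes.\<close>

lemma Sat_subset_of_boolean_closed:
  assumes alg: "algebra A" and reg: "\<B> \<subseteq> Lang_r A" and nab: "Sat A (nabla A) \<subseteq> \<B>"
    and un: "\<And>L L'. L \<in> \<B> \<Longrightarrow> L' \<in> \<B> \<Longrightarrow> (\<lambda>s. L s \<union> L' s) \<in> \<B>"
    and int: "\<And>L L'. L \<in> \<B> \<Longrightarrow> L' \<in> \<B> \<Longrightarrow> (\<lambda>s. L s \<inter> L' s) \<in> \<B>"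
    and compl: "\<And>L. L \<in> \<B> \<Longrightarrow> (\<lambda>s. carr A s - L s) \<in> \<B>"
    and vim: "\<And>L s t T. L \<in> \<B> \<Longrightarrow> s \<in> S \<Longrightarrow> t \<in> S \<Longrightarrow> T \<in> Tl A t s \<Longrightarrow>
      vimage_trans A t s T L \<in> \<B>"
    and L: "L \<in> \<B>" and L': "L' \<in> \<B>"
  shows "Sat A (\<lambda>s. Omega A L s \<inter> Omega A L' s) \<subseteq> \<B>"
proof
  fix K
  assume K: "K \<in> Sat A (\<lambda>s. Omega A L s \<inter> Omega A L' s)"
  define \<Phi> where "\<Phi> s = Omega A L s \<inter> Omega A L' s" for s
  define Q where "Q L = (SIGMA s:S. carr A s // Omega A L s)" for L
  \<comment> \<open>Classes are tagged with their sort, since equal sets may occur in different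
    sorts.\<close>
  define P where "P = {(s, C). s \<in> S \<and> C \<in> carr A s // \<Phi> s \<and> C \<subseteq> K s}"
  have sub: "\<And>s. L s \<subseteq> carr A s" "\<And>s. L' s \<subseteq> carr A s"
    using L L' reg Lang_r_subset_carr by blast+
  have class_eq: "\<Phi> s `` {x} = Omega A L s `` {x} \<inter> Omega A L' s `` {x}" for s x
    by (auto simp: \<Phi>_def)
  have "finite (Q L \<times> Q L')"
    using L L' reg by (auto simp: Lang_r_def finite_index_def Q_def)
  then have "finite ((\<lambda>((s, C), (s', C')). (s, C \<inter> C')) ` (Q L \<times> Q L'))"
    by (rule finite_imageI)
  \<comment> \<open>The map ignores the second sort, so its image may contain spurious pairs;
    inclusion suffices for finiteness.\<close>
  moreover have "P \<subseteq> (\<lambda>((s, C), (s', C')). (s, C \<inter> C')) ` (Q L \<times> Q L')"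
  proof
    fix p
    assume "p \<in> P"
    then obtain s x where p: "p = (s, \<Phi> s `` {x})" "s \<in> S" "x \<in> carr A s"
      by (auto simp: P_def elim: quotientE)
    then have "((s, Omega A L s `` {x}), (s, Omega A L' s `` {x})) \<in> Q L \<times> Q L'"
      by (auto simp: Q_def intro: quotientI)
    then show "p \<in> (\<lambda>((s, C), (s', C')). (s, C \<inter> C')) ` (Q L \<times> Q L')"
      by (rule rev_image_eqI) (simp add: p class_eq)
  qed
  ultimately have finP: "finite P"
    by (rule rev_finite_subset)
  have conc: "concentrated s C \<in> \<B>" if "(s, C) \<in> P" for s C
  proof -
    obtain x where x: "x \<in> carr A s" "C = \<Phi> s `` {x}"
      using \<open>(s, C) \<in> P\<close> by (auto simp: P_def elim: quotientE)
    have "concentrated s C = (\<lambda>u. concentrated s (Omega A L s `` {x}) u \<inter>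
        concentrated s (Omega A L' s `` {x}) u)"
      by (auto simp: x class_eq concentrated_def fun_eq_iff)
    moreover have "concentrated s (Omega A L s `` {x}) \<in> \<B>"
      using concentrated_Omega_class[OF alg reg nab int compl vim L x(1)] .
    moreover have "concentrated s (Omega A L' s `` {x}) \<in> \<B>"
      using concentrated_Omega_class[OF alg reg nab int compl vim L' x(1)] .
    ultimately show ?thesis
      using int by simp
  qed
  have "(\<lambda>u. \<Union>{C. (u, C) \<in> R}) \<in> \<B>" if "finite R" "R \<subseteq> P" for R
    using that
  proof induction
    case empty
    then show ?case
      \<comment> \<open>The empty union is the language empty in every sort, which is saturated for
        \<open>nabla\<close>.\<close>
      using nab by (auto simp: Sat_nabla_iff[OF alg])
  next
    case (insert p R)
    obtain s C where p: "p = (s, C)"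
      by force
    have "(\<lambda>u. \<Union>{C. (u, C) \<in> insert p R}) =
        (\<lambda>u. concentrated s C u \<union> \<Union>{C. (u, C) \<in> R})"
      by (auto simp: p concentrated_def fun_eq_iff)
    then show ?case
      using insert conc un p by simp
  qed
  then have "(\<lambda>u. \<Union>{C. (u, C) \<in> P}) \<in> \<B>"
    using finP by blast
  moreover have "\<Union>{C. (u, C) \<in> P} = K u" for u
  proof
    show "\<Union>{C. (u, C) \<in> P} \<subseteq> K u"
      by (auto simp: P_def)
    show "K u \<subseteq> \<Union>{C. (u, C) \<in> P}"
    proof
      fix x
      assume x: "x \<in> K u"
      have K': "K u \<subseteq> carr A u" "\<And>y. (x, y) \<in> \<Phi> u \<Longrightarrow> y \<in> K u"
        using K x unfolding Sat_inf_Omega_iff[of A L L' K, OF alg sub] \<Phi>_def by blast+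
      then have "u \<in> S"
        using alg x by (auto simp: algebra_def)
      then have "(u, \<Phi> u `` {x}) \<in> P"
        using K' x by (auto simp: P_def intro: quotientI)
      moreover have "x \<in> \<Phi> u `` {x}"
        using equiv_class_self[OF equiv_inf_Omega[of A L L', OF alg sub]] K' x
        by (auto simp: \<Phi>_def)
      ultimately show "x \<in> \<Union>{C. (u, C) \<in> P}"
        by blast
    qed
  qed
  ultimately show "K \<in> \<B>"
    by simp
qed

section \<open>Lifting translations along an epimorphism onto a quotient\<close>

text \<open>Each fixed argument of an elementary translation of \<open>B\<close> is replaced by an
  element of \<open>A\<close> whose image is congruent to it. As \<open>f\<close> is a homomorphism
  and \<open>Omega B M\<close> a congruence, the two results stay congruent, by induction along the
  composite.\<close>

lemma translation_lift:
  assumes "translation B t s T'"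
    and alg: "algebra A" "algebra B" and M: "\<And>s. M s \<subseteq> carr B s" and f: "hom A B f"
    and epi: "epi A (quotient_alg B (Omega B M)) (\<lambda>s. proj (Omega B M) s \<circ> f s)"
  shows "\<exists>T. translation A t s T \<and> (\<forall>x\<in>carr A t. (f s (T x), T' (f t x)) \<in> Omega B M s)"
  using assms(1)
proof induction
  case trans_id
  have "(f t x, f t x) \<in> Omega B M t" if "x \<in> carr A t" for x
    using hom_closed[OF f that] equiv_Omega[OF alg(2) M, of t] by (simp add: equiv_def refl_on_def)
  then show ?case
    using translation.trans_id[OF trans_id] by blast
next
  case (trans_comp s T' u E')
  obtain T where T: "translation A t s T"
    "\<And>x. x \<in> carr A t \<Longrightarrow> (f s (T x), T' (f t x)) \<in> Omega B M s"
    using trans_comp by blast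
  obtain w \<sigma> i bs where w: "\<sigma> \<in> \<Sigma> w u" "i < length w" "w ! i = s"
      "\<And>x. x \<in> carr B s \<Longrightarrow> bs[i := x] \<in> words_over (carr B) w"
      "E' = (\<lambda>x. opr B w u \<sigma> (bs[i := x]))" "length bs = length w"
      "\<And>j. j < length w \<Longrightarrow> j \<noteq> i \<Longrightarrow> bs ! j \<in> carr B (w ! j)"
    using elementary_translationE[OF trans_comp(2)] by metis
  \<comment> \<open>Only the composite with the projection is surjective, so \<open>b\<close> is
    reached up to \<open>Omega B M\<close>, not exactly.\<close>
  have "\<exists>a \<in> carr A v. (f v a, b) \<in> Omega B M v" if "b \<in> carr B v" for b v
  proof -
    have "(\<lambda>x. Omega B M v `` {f v x}) ` carr A v = carr B v // Omega B M v"
      using epi by (simp add: epi_def quotient_alg_def proj_def)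
    then have "Omega B M v `` {b} \<in> (\<lambda>x. Omega B M v `` {f v x}) ` carr A v"
      using that by (simp add: quotientI)
    then obtain a where "a \<in> carr A v" "Omega B M v `` {b} = Omega B M v `` {f v a}"
      by blast
    moreover have "f v a \<in> carr B v"
      using hom_closed[OF f \<open>a \<in> carr A v\<close>] .
    ultimately show ?thesis
      using eq_equiv_class[OF _ equiv_Omega[OF alg(2) M] that] by (metis that)
  qed
  then have "\<forall>v b. \<exists>a. b \<in> carr B v \<longrightarrow> a \<in> carr A v \<and> (f v a, b) \<in> Omega B M v"
    by blast
  then obtain g where
    g: "\<And>b v. b \<in> carr B v \<Longrightarrow> g v b \<in> carr A v \<and> (f v (g v b), b) \<in> Omega B M v"
    unfolding choice_iff by blast
  \<comment> \<open>The entry at position \<open>i\<close> may be meaningless, as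
    \<open>bs ! i\<close> need not lie in the carrier; it is always overwritten.\<close>
  define as where "as = map2 g w bs"
  have las: "length as = length w"
    by (simp add: as_def w)
  have as: "as ! j \<in> carr A (w ! j)" "(f (w ! j) (as ! j), bs ! j) \<in> Omega B M (w ! j)"
    if "j < length w" "j \<noteq> i" for j
    using that g w by (simp_all add: as_def)
  define E where "E = (\<lambda>x. opr A w u \<sigma> (as[i := x]))"
  have E: "elementary_translation A s u E"
    using w as las unfolding elementary_translation_def E_def by blast
  have "(f u (E (T x)), E' (T' (f t x))) \<in> Omega B M u" if x: "x \<in> carr A t" for x
  proof -
    have Tx: "T x \<in> carr A s"
      using translation_closed[OF T(1) alg(1) x] .
    have T'x: "T' (f t x) \<in> carr B s"
      using translation_closed[OF trans_comp(1) alg(2) hom_closed[OF f x]] .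
    have xs: "as[i := T x] \<in> words_over (carr A) w"
      using Tx as las w by (auto simp: words_over_nth_iff nth_list_update)
    then have "f u (E (T x)) = opr B w u \<sigma> (map2 f w (as[i := T x]))"
      using f w by (simp add: hom_def E_def)
    moreover have "map2 f w (as[i := T x]) \<in> words_over (carr B) w"
      using xs by (auto simp: words_over_nth_iff hom_closed[OF f])
    \<comment> \<open>At position \<open>i\<close> this is the induction hypothesis; at the other
      positions it is the choice of \<open>g\<close>.\<close>
    moreover have "(map2 f w (as[i := T x]) ! j, bs[i := T' (f t x)] ! j) \<in> Omega B M (w ! j)"
      if "j < length w" for j
      using that as las w T(2)[OF x] by (cases "j = i") simp_all
    ultimately show ?thesis
      using congruence_Omega[OF alg(2) M] w T'x unfolding congruence_def by metis
  qed
  then show ?case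
    using translation.trans_comp[OF T(1) E] by blast
qed

text \<open>A translation of \<open>B\<close> separating \<open>f s x\<close> from
  \<open>f s y\<close> with respect to \<open>M\<close> lifts to one of \<open>A\<close> separating
  \<open>x\<close> from \<open>y\<close> with respect to the inverse image. The error in the lift is
  harmless because \<open>Omega B M\<close> saturates \<open>M\<close>.\<close>

lemma Omega_vimage_subset_Ker:
  assumes alg: "algebra A" "algebra B" and M: "\<And>s. M s \<subseteq> carr B s" and f: "hom A B f"
    and epi: "epi A (quotient_alg B (Omega B M)) (\<lambda>s. proj (Omega B M) s \<circ> f s)"
  shows "Omega A (\<lambda>s. {p \<in> carr A s. f s p \<in> M s}) s
    \<subseteq> Ker A (\<lambda>s. proj (Omega B M) s \<circ> f s) s"
proof clarify
  fix x y
  assume "(x, y) \<in> Omega A (\<lambda>s. {p \<in> carr A s. f s p \<in> M s}) s"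
  then have xy: "x \<in> carr A s" "y \<in> carr A s" and
    T: "\<And>u T. translation A s u T \<Longrightarrow>
      T x \<in> {p \<in> carr A u. f u p \<in> M u} \<longleftrightarrow> T y \<in> {p \<in> carr A u. f u p \<in> M u}"
    by (auto simp: Omega_eq[OF alg(1)] inseparable_def)
  have "T' (f s x) \<in> M u \<longleftrightarrow> T' (f s y) \<in> M u" if T': "translation B s u T'" for u T'
  proof -
    obtain T where T1: "translation A s u T"
      and T2: "\<And>x. x \<in> carr A s \<Longrightarrow> (f u (T x), T' (f s x)) \<in> Omega B M u"
      using translation_lift[OF T' alg M f epi] by blast
    have "f u (T x) \<in> M u \<longleftrightarrow> f u (T y) \<in> M u"
      using T[OF T1] translation_closed[OF T1 alg(1)] xy by blast
    then show ?thesis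
      using Omega_saturates[OF alg(2) M T2] xy by blast
  qed
  then have "(f s x, f s y) \<in> Omega B M s"
    using xy hom_closed[OF f] by (auto simp: Omega_eq[OF alg(2) M] inseparable_def)
  then have "Omega B M s `` {f s x} = Omega B M s `` {f s y}"
    by (rule equiv_class_eq[OF equiv_Omega[OF alg(2) M]])
  then show "(x, y) \<in> Ker A (\<lambda>s. proj (Omega B M) s \<circ> f s) s"
    using xy by (simp add: Ker_def proj_def)
qed

section \<open>Kernel saturation and the two implications\<close>

lemma Sat_Ker_iff:
  "K \<in> Sat A (Ker A f) \<longleftrightarrow> (\<forall>s. K s \<subseteq> carr A s) \<and>
    (\<forall>s x y. (x, y) \<in> Ker A f s \<longrightarrow> x \<in> K s \<longrightarrow> y \<in> K s)"
  by (rule Sat_iff) (auto simp: Ker_def equiv_def refl_on_def sym_def trans_def)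

text \<open>Elements of \<open>A\<close> identified by the kernel have images in the same class of
  \<open>Omega B M\<close>, which lies inside \<open>M\<close> or misses it. This derives (BPS 4)
  from (3).\<close>

lemma vimage_in_Sat_Ker:
  assumes alg: "algebra B" and M: "\<And>s. M s \<subseteq> carr B s" and f: "hom A B f"
  shows "(\<lambda>s. {p \<in> carr A s. f s p \<in> M s}) \<in> Sat A (Ker A (\<lambda>s. proj (Omega B M) s \<circ> f s))"
proof -
  have "f s y \<in> M s"
    if "(x, y) \<in> Ker A (\<lambda>s. proj (Omega B M) s \<circ> f s) s" "f s x \<in> M s" for s x y
  proof -
    have xy: "y \<in> carr A s" "Omega B M s `` {f s x} = Omega B M s `` {f s y}"
      using that by (auto simp: Ker_def proj_def)
    have "f s y \<in> carr B s"
      by (rule hom_closed[OF f xy(1)])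
    then have "(f s x, f s y) \<in> Omega B M s"
      using eq_equiv_class[OF xy(2) equiv_Omega[OF alg M]] by blast
    then show ?thesis
      using Omega_saturates[OF alg M] that by blast
  qed
  then show ?thesis
    by (auto simp: Sat_Ker_iff) (auto simp: Ker_def)
qed

text \<open>Inseparable elements agree under \<open>T\<close> by definition. The intersection of
  \<open>Omega A L\<close> with itself matches condition (2) taken with \<open>L' = L\<close>, which
  yields (BPS 2).\<close>

lemma vimage_trans_in_Sat_Omega:
  assumes alg: "algebra A" and L: "\<And>s. L s \<subseteq> carr A s" and T: "T \<in> Tl A t s"
  shows "vimage_trans A t s T L \<in> Sat A (\<lambda>s. Omega A L s \<inter> Omega A L s)"
  using T unfolding Sat_inf_Omega_iff[of A L L, OF alg L L]
  unfolding Omega_eq[OF alg L]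
  by (auto simp: vimage_trans_def inseparable_def Tl_def split: if_splits)

lemma formation_imp_bps_formation:
  assumes "formation \<U> \<L>"
  shows "bps_formation \<U> \<L>"
proof -
  note F = assms[unfolded formation_def Let_def]
  note alg = algebra_free_alg
  have sub: "\<And>s. L s \<subseteq> carr (free_alg A) s" if "A \<in> sorted_sets S \<U>" "L \<in> \<L> A" for A L
    using F that Lang_r_subset_carr by blast
  have sat: "K \<in> \<L> A" if "A \<in> sorted_sets S \<U>" "L \<in> \<L> A" "L' \<in> \<L> A"
    "K \<in> Sat (free_alg A) (\<lambda>s. Omega (free_alg A) L s \<inter> Omega (free_alg A) L' s)" for A L L' K
    using F that by blast
  have translates: "vimage_trans (free_alg A) t s T L \<in> \<L> A"
    if "A \<in> sorted_sets S \<U>" "L \<in> \<L> A" "T \<in> Tl (free_alg A) t s" for A L s t T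
    using sat[OF that(1,2,2)] vimage_trans_in_Sat_Omega[OF alg sub[OF that(1,2)] that(3)] .
  have boolean: "(\<lambda>s. L s \<union> L' s) \<in> \<L> A \<and> (\<lambda>s. L s \<inter> L' s) \<in> \<L> A \<and>
      (\<lambda>s. carr (free_alg A) s - L s) \<in> \<L> A"
    if A: "A \<in> sorted_sets S \<U>" and L: "L \<in> \<L> A" and L': "L' \<in> \<L> A" for A L L'
  proof -
    note s = sub[OF A L] sub[OF A L']
    note iff = Sat_inf_Omega_iff[of "free_alg A" L L', OF alg s]
    note om = Omega_saturates[OF alg s(1)] Omega_saturates[OF alg s(2)]
    have "(\<lambda>s. L s \<union> L' s) \<in> Sat (free_alg A)
        (\<lambda>s. Omega (free_alg A) L s \<inter> Omega (free_alg A) L' s)"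
      unfolding iff using s om by blast
    moreover have "(\<lambda>s. L s \<inter> L' s) \<in> Sat (free_alg A)
        (\<lambda>s. Omega (free_alg A) L s \<inter> Omega (free_alg A) L' s)"
      unfolding iff using s om by blast
    moreover have "(\<lambda>s. carr (free_alg A) s - L s) \<in> Sat (free_alg A)
        (\<lambda>s. Omega (free_alg A) L s \<inter> Omega (free_alg A) L' s)"
      \<comment> \<open>For the complement, a related element must also be known to lie in the
        carrier, which \<open>equiv_type\<close> provides.\<close>
      unfolding iff using om equiv_type[OF equiv_Omega[OF alg s(1)]] by blast
    ultimately show ?thesis
      using sat[OF A L L'] by blast
  qed
  have vimages: "(\<lambda>s. {p \<in> carr (free_alg A) s. f s p \<in> M s}) \<in> \<L> A"
    if "A \<in> sorted_sets S \<U>" "B \<in> sorted_sets S \<U>" "M \<in> \<L> B" "hom (free_alg A) (free_alg B) f"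
      "epi (free_alg A) (quotient_alg (free_alg B) (Omega (free_alg B) M))
        (\<lambda>s. proj (Omega (free_alg B) M) s \<circ> f s)" for A B M f
    using F that vimage_in_Sat_Ker[OF alg sub[OF that(2,3)] that(4)] by blast
  show ?thesis
    unfolding bps_formation_def Let_def
    by (intro conjI[OF F[THEN conjunct1]] conjI[OF F[THEN conjunct2, THEN conjunct1]]
        conjI[of "Ball _ _"] ballI allI impI translates boolean vimages)
qed

lemma bps_formation_imp_formation:
  assumes "bps_formation \<U> \<L>"
  shows "formation \<U> \<L>"
proof -
  note F = assms[unfolded bps_formation_def Let_def]
  note alg = algebra_free_alg
  have sub: "\<And>s. L s \<subseteq> carr (free_alg A) s" if "A \<in> sorted_sets S \<U>" "L \<in> \<L> A" for A L
    using F that Lang_r_subset_carr by blast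
  have sat: "Sat (free_alg A) (\<lambda>s. Omega (free_alg A) L s \<inter> Omega (free_alg A) L' s) \<subseteq> \<L> A"
    if "A \<in> sorted_sets S \<U>" "L \<in> \<L> A" "L' \<in> \<L> A" for A L L'
    by (rule Sat_subset_of_boolean_closed[OF alg]) (use F that in blast)+
  have kernels: "Sat (free_alg A) (Ker (free_alg A) (\<lambda>s. proj (Omega (free_alg B) M) s \<circ> f s)) \<subseteq> \<L> A"
    if A: "A \<in> sorted_sets S \<U>" and B: "B \<in> sorted_sets S \<U>" and M: "M \<in> \<L> B"
      and f: "hom (free_alg A) (free_alg B) f"
      and epi: "epi (free_alg A) (quotient_alg (free_alg B) (Omega (free_alg B) M))
        (\<lambda>s. proj (Omega (free_alg B) M) s \<circ> f s)" for A B M f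
  proof
    fix K
    assume K: "K \<in> Sat (free_alg A) (Ker (free_alg A) (\<lambda>s. proj (Omega (free_alg B) M) s \<circ> f s))"
    define N where "N = (\<lambda>s. {p \<in> carr (free_alg A) s. f s p \<in> M s})"
    have N: "N \<in> \<L> A"
      using F A B M f epi unfolding N_def by blast
    have "Omega (free_alg A) N s
        \<subseteq> Ker (free_alg A) (\<lambda>s. proj (Omega (free_alg B) M) s \<circ> f s) s" for s
      unfolding N_def by (rule Omega_vimage_subset_Ker[OF alg alg sub[OF B M] f epi])
    \<comment> \<open>A finer congruence has more saturated languages, so kernel saturation passes
      to \<open>Omega (free_alg A) N\<close>, where (2) applies with both languages equal to
      \<open>N\<close>.\<close>
    then have "K \<in> Sat (free_alg A) (\<lambda>s. Omega (free_alg A) N s \<inter> Omega (free_alg A) N s)"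
      using K unfolding Sat_inf_Omega_iff[of "free_alg A" N N, OF alg sub[OF A N] sub[OF A N]]
        Sat_Ker_iff by blast
    then show "K \<in> \<L> A"
      using sat[OF A N N] by blast
  qed
  show ?thesis
    unfolding formation_def Let_def
    by (intro conjI[OF F[THEN conjunct1]] conjI[OF F[THEN conjunct2, THEN conjunct1]]
        conjI[of "Ball _ _"] ballI allI impI sat kernels)
qed

end

theorem proposition6p19:
  fixes S :: "'s set"
    and \<Sigma> :: "'s list \<Rightarrow> 's \<Rightarrow> 'o set"
    and \<U> :: "'a set set"
    and \<L> :: "('s \<Rightarrow> 'a set) \<Rightarrow> ('s \<Rightarrow> ('s, 'o, 'a) trm set) set"
  assumes "signature S \<Sigma>"
    and "\<And>A. A \<in> sorted_sets S \<U> \<Longrightarrow> finite {s \<in> S. carr (signature.free_alg S \<Sigma> A) s \<noteq> {}}"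
    and "\<And>A. A \<in> sorted_sets S \<U> \<Longrightarrow>
           \<L> A \<subseteq> signature.Lang_r S \<Sigma> (signature.free_alg S \<Sigma> A)"
  shows "signature.formation S \<Sigma> \<U> \<L> \<longleftrightarrow> signature.bps_formation S \<Sigma> \<U> \<L>"
proof -
  interpret signature S \<Sigma>
    by fact
  show ?thesis
    using formation_imp_bps_formation bps_formation_imp_formation by blast
qed

end
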